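(* Let $G$ be a finite forest with at least one vertex. Then $$\Delta(G)=\max\{|\det\tilde L(G',G'')| : G''\subseteq G'\subseteq G\},$$ where the maximum ranges over subgraphs $G'$ of $G$ (necessarily forests) and induced subgraphs $G''$ of $G'$. Moreover, provided every connected component of $G$ has at least three vertices, the maximum is attained by a pair $(G',G'')$ such that every edge of $G'$ has at least one endpoint in $V(G'')$ and $d_{G'}(v)\ge2$ for all $v\in V(G'')$.
   Context: For a finite simple graph $G$, the elements of $G$ are its vertices and edges. Two elements $\alpha,\beta\in V(G)\cup E(G)$ are incident if $\alpha=\beta$, or one is an edge and the other is an endpoint of that edge. $M(G)$ is the $0/1$ matrix with rows and columns indexed by $V(G)\cup E(G)$ whose $(\alpha,\beta)$ entry is $1$ iff $\alpha$ and $\beta$ are incident; equivalently $M(G)=\begin{bmatrix} I & B\\ B^\intercal & I\end{bmatrix}$ where $B$ is the vertex-edge incidence matrix of $G$. $\Delta(G)$ denotes the maximum of $|\det M'|$ over all square submatrices $M'$ of $M(G)$. For a subgraph $G'$ of $G$ and an induced subgraph $G''$ of $G'$ with vertices $v_1,\dots,v_k$, $\tilde L(G',G'')$ is the $k\times k$ matrix $A(G'')+\mathrm{diag}(d_{G'}(v_1)-1,\dots,d_{G'}(v_k)-1)$, where $A(G'')$ is the adjacency matrix of $G''$ and $d_{G'}(v)$ is the degree of $v$ in $G'$. *)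

theory Defs
  imports "Jordan_Normal_Form.Determinant" "Jordan_Normal_Form.DL_Submatrix"
begin

record 'a sgraph =
  verts :: "'a set"
  edges :: "'a set set"

definition simple_graph :: "'a sgraph \<Rightarrow> bool" where
  "simple_graph G \<longleftrightarrow> finite (verts G) \<and> (\<forall>e\<in>edges G. e \<subseteq> verts G \<and> card e = 2)"

definition subgraph :: "'a sgraph \<Rightarrow> 'a sgraph \<Rightarrow> bool" where
  "subgraph H G \<longleftrightarrow> simple_graph H \<and> verts H \<subseteq> verts G \<and> edges H \<subseteq> edges G"

definition induced_subgraph :: "'a sgraph \<Rightarrow> 'a sgraph \<Rightarrow> bool" where
  "induced_subgraph H G \<longleftrightarrow> verts H \<subseteq> verts G \<and> edges H = {e \<in> edges G. e \<subseteq> verts H}"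

definition vdegree :: "'a sgraph \<Rightarrow> 'a \<Rightarrow> nat" where
  "vdegree G v = card {e \<in> edges G. v \<in> e}"

text \<open>A cycle is given by the cyclic sequence of its (at least three, distinct) vertices.\<close>

definition is_cycle :: "'a sgraph \<Rightarrow> 'a list \<Rightarrow> bool" where
  "is_cycle G vs \<longleftrightarrow> length vs \<ge> 3 \<and> distinct vs \<and>
     (\<forall>i < length vs. {vs ! i, vs ! (Suc i mod length vs)} \<in> edges G)"

definition forest :: "'a sgraph \<Rightarrow> bool" where
  "forest G \<longleftrightarrow> simple_graph G \<and> (\<nexists>vs. is_cycle G vs)"

definition adj_rel :: "'a sgraph \<Rightarrow> ('a \<times> 'a) set" where
  "adj_rel G = {(u, v). {u, v} \<in> edges G}"

definition components :: "'a sgraph \<Rightarrow> 'a set set" where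
  "components G = {{u. (v, u) \<in> (adj_rel G)\<^sup>*} | v. v \<in> verts G}"

text \<open>The disjoint union of vertices and edges; \<open>Inl\<close> tags vertices and \<open>Inr\<close> tags edges.\<close>

definition elements :: "'a sgraph \<Rightarrow> ('a + 'a set) set" where
  "elements G = verts G <+> edges G"

definition incident :: "'a + 'a set \<Rightarrow> 'a + 'a set \<Rightarrow> bool" where
  "incident \<alpha> \<beta> \<longleftrightarrow> \<alpha> = \<beta> \<or>
     (\<exists>v e. v \<in> e \<and> (\<alpha> = Inl v \<and> \<beta> = Inr e \<or> \<alpha> = Inr e \<and> \<beta> = Inl v))"

definition enumerates :: "'b list \<Rightarrow> 'b set \<Rightarrow> bool" where
  "enumerates xs S \<longleftrightarrow> distinct xs \<and> set xs = S"

text \<open>Matrices indexed by a finite set are written down along an enumeration \<open>xs\<close> of that set.\<close>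

definition inc_matrix :: "('a + 'a set) list \<Rightarrow> int mat" where
  "inc_matrix xs = mat (length xs) (length xs) (\<lambda>(i, j). if incident (xs ! i) (xs ! j) then 1 else 0)"

text \<open>Each enumeration \<open>xs\<close> yields the same set of absolute values of minors.
  The condition \<open>I \<noteq> {}\<close> leaves out the \<open>0 \<times> 0\<close> submatrix.\<close>

definition abs_minors :: "'a sgraph \<Rightarrow> int set" where
  "abs_minors G = {\<bar>det (submatrix (inc_matrix xs) I J)\<bar> | xs I J.
     enumerates xs (elements G) \<and> I \<subseteq> {..<length xs} \<and> J \<subseteq> {..<length xs} \<and>
     card I = card J \<and> I \<noteq> {}}"

definition Delta :: "'a sgraph \<Rightarrow> int" where
  "Delta G = Max (abs_minors G)"

definition Ltilde :: "'a sgraph \<Rightarrow> 'a sgraph \<Rightarrow> 'a list \<Rightarrow> int mat" where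
  "Ltilde G' G'' vs = mat (length vs) (length vs) (\<lambda>(i, j).
     (if {vs ! i, vs ! j} \<in> edges G'' then 1 else 0) +
     (if i = j then int (vdegree G' (vs ! i)) - 1 else 0))"

text \<open>Graphs \<open>G''\<close> without vertices are left out, as their matrix would be \<open>0 \<times> 0\<close>.\<close>

definition nested_pair :: "'a sgraph \<Rightarrow> 'a sgraph \<Rightarrow> 'a sgraph \<Rightarrow> bool" where
  "nested_pair G G' G'' \<longleftrightarrow> subgraph G' G \<and> induced_subgraph G'' G' \<and> verts G'' \<noteq> {}"

definition Ltilde_dets :: "'a sgraph \<Rightarrow> int set" where
  "Ltilde_dets G = {\<bar>det (Ltilde G' G'' vs)\<bar> | G' G'' vs.
     nested_pair G G' G'' \<and> enumerates vs (verts G'')}"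

lemma subgraph_forest: "subgraph H G \<Longrightarrow> forest G \<Longrightarrow> forest H"
  unfolding subgraph_def forest_def is_cycle_def by blast

lemma finite_edges: "simple_graph G \<Longrightarrow> finite (edges G)"
  by (rule finite_subset[of _ "Pow (verts G)"]) (auto simp: simple_graph_def)

lemma finite_enumerations: "finite S \<Longrightarrow> finite {xs. enumerates xs S}"
  by (rule finite_subset[OF _ finite_lists_length_eq[of S "card S"]])
     (auto simp: enumerates_def distinct_card)

lemma ex_enumerates: "finite S \<Longrightarrow> \<exists>xs. enumerates xs S"
  using finite_distinct_list by (auto simp: enumerates_def)

text \<open>Both sets are finite and nonempty, so that \<open>Max\<close> is a genuine maximum.\<close>

lemma finite_abs_minors:
  assumes "simple_graph G"
  shows "finite (abs_minors G)"
proof -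
  let ?X = "{xs. enumerates xs (elements G)}"
  let ?P = "\<lambda>xs :: ('a + 'a set) list. Pow {..<length xs}"
  have "finite (elements G)"
    using assms finite_edges[OF assms] by (simp add: elements_def simple_graph_def)
  then have "finite (Sigma ?X (\<lambda>xs. ?P xs \<times> ?P xs))"
    by (simp add: finite_enumerations)
  then have "finite ((\<lambda>(xs, I, J). \<bar>det (submatrix (inc_matrix xs) I J)\<bar>) `
      Sigma ?X (\<lambda>xs. ?P xs \<times> ?P xs))"
    by (rule finite_imageI)
  then show ?thesis
  proof (rule rev_finite_subset, intro subsetI)
    fix x assume "x \<in> abs_minors G"
    then obtain xs I J where *: "x = \<bar>det (submatrix (inc_matrix xs) I J)\<bar>"
      "enumerates xs (elements G)" "I \<subseteq> {..<length xs}" "J \<subseteq> {..<length xs}"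
      unfolding abs_minors_def by blast
    then show "x \<in> (\<lambda>(xs, I, J). \<bar>det (submatrix (inc_matrix xs) I J)\<bar>) `
        Sigma ?X (\<lambda>xs. ?P xs \<times> ?P xs)"
      by (intro image_eqI[of _ _ "(xs, I, J)"]) auto
  qed
qed

lemma abs_minors_nonempty:
  assumes "simple_graph G" "verts G \<noteq> {}"
  shows "abs_minors G \<noteq> {}"
proof -
  have "finite (elements G)"
    using assms finite_edges[OF assms(1)] by (simp add: elements_def simple_graph_def)
  then obtain xs where xs: "enumerates xs (elements G)"
    using ex_enumerates by blast
  moreover have "elements G \<noteq> {}"
    using assms(2) by (auto simp: elements_def)
  ultimately have "{..<length xs} \<noteq> {}"
    by (auto simp: enumerates_def lessThan_empty_iff)
  with xs show ?thesis
    unfolding abs_minors_def by blast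
qed

lemma finite_Ltilde_dets:
  assumes "simple_graph G"
  shows "finite (Ltilde_dets G)"
proof -
  define HH :: "'a sgraph set"
    where "HH = (\<lambda>(V, E). \<lparr>verts = V, edges = E\<rparr>) ` (Pow (verts G) \<times> Pow (edges G))"
  let ?S = "HH \<times> Sigma HH (\<lambda>H. {vs. enumerates vs (verts H)})"
  have fin: "finite HH"
    using assms finite_edges[OF assms] by (simp add: HH_def simple_graph_def)
  have mem: "H \<in> HH" if "verts H \<subseteq> verts G" "edges H \<subseteq> edges G" for H :: "'a sgraph"
    unfolding HH_def by (rule image_eqI[of _ _ "(verts H, edges H)"]) (use that in simp_all)
  have "finite (verts H)" if "H \<in> HH" for H
    using that assms by (auto simp: HH_def simple_graph_def dest: finite_subset)
  then have "finite ?S"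
    using fin by (intro finite_cartesian_product finite_SigmaI finite_enumerations)
  then have "finite ((\<lambda>(G', G'', vs). \<bar>det (Ltilde G' G'' vs)\<bar>) ` ?S)"
    by (rule finite_imageI)
  then show ?thesis
  proof (rule rev_finite_subset, intro subsetI)
    fix x assume "x \<in> Ltilde_dets G"
    then obtain G' G'' vs where *: "x = \<bar>det (Ltilde G' G'' vs)\<bar>"
      "nested_pair G G' G''" "enumerates vs (verts G'')"
      unfolding Ltilde_dets_def by blast
    have "G' \<in> HH" "G'' \<in> HH"
      using *(2) by (auto simp: nested_pair_def subgraph_def induced_subgraph_def intro!: mem)
    with *(3) have "(G', G'', vs) \<in> ?S"
      by simp
    then show "x \<in> (\<lambda>(G', G'', vs). \<bar>det (Ltilde G' G'' vs)\<bar>) ` ?S"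
      by (rule rev_image_eqI) (simp add: *(1))
  qed
qed

lemma Ltilde_dets_nonempty:
  assumes "simple_graph G" "verts G \<noteq> {}"
  shows "Ltilde_dets G \<noteq> {}"
proof -
  have "edges G = {e \<in> edges G. e \<subseteq> verts G}"
    using assms(1) by (auto simp: simple_graph_def)
  then have "nested_pair G G G"
    using assms unfolding nested_pair_def subgraph_def induced_subgraph_def by simp
  moreover have "finite (verts G)"
    using assms(1) by (simp add: simple_graph_def)
  then obtain vs where "enumerates vs (verts G)"
    using ex_enumerates by blast
  ultimately have "\<bar>det (Ltilde G G vs)\<bar> \<in> Ltilde_dets G"
    unfolding Ltilde_dets_def by (intro CollectI exI conjI) (rule refl)
  then show ?thesis
    by blast
qed

end

theory Submission
  imports Defs
begin

text \<open>
  \<open>M(G)\<close> is \<open>I + A\<close>, where \<open>A\<close> is the adjacency matrix of the subdivision of \<open>G\<close>, which is again a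
  forest. Eliminating the edge elements from the principal submatrix on \<open>V'' \<union> E'\<close> leaves the Schur
  complement \<open>I - B B\<^sup>T = - Ltilde\<close>, so the principal minors are, up to sign, the determinants of the
  matrices \<open>Ltilde\<close>. Every other minor of a matrix \<open>D + A\<close> with \<open>A\<close> the adjacency matrix of a forest
  and \<open>D\<close> diagonal is zero or, up to sign, a principal minor; this follows by stripping leaves.

  For the second part, a vertex of \<open>V''\<close> of degree 0 in \<open>G'\<close> contributes a factor \<open>-1\<close>, and one of
  degree 1 has a row with a single nonzero entry, at its neighbour; in either case expansion removes
  vertices from \<open>V''\<close> without changing the absolute value of the determinant. If nothing remains,
  the maximum is 1, which is also attained by the middle vertex of a path with two edges.
\<close>

section \<open>Determinants indexed by finite sets\<close>

text \<open>Entries are addressed by labels instead of positions, so deleting rows and columns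
  leaves \<open>f\<close> unchanged. The values are rational because pivoting divides by an
  entry.\<close>

definition list_det :: "('b \<Rightarrow> 'c \<Rightarrow> rat) \<Rightarrow> 'b list \<Rightarrow> 'c list \<Rightarrow> rat" where
  "list_det f xs ys = det (mat (length xs) (length ys) (\<lambda>(i, j). f (xs ! i) (ys ! j)))"

lemma list_det_transpose:
  assumes "length xs = length ys"
  shows "list_det (\<lambda>b a. f a b) ys xs = list_det f xs ys"
proof -
  let ?A = "mat (length xs) (length ys) (\<lambda>(i, j). f (xs ! i) (ys ! j))"
  have "list_det f xs ys = det (transpose_mat ?A)"
    unfolding list_det_def by (rule det_transpose[symmetric, of _ "length xs"]) (simp add: assms)
  also have "transpose_mat ?A = mat (length ys) (length xs) (\<lambda>(i, j). f (xs ! j) (ys ! i))"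
    by (rule eq_matI) auto
  finally show ?thesis
    by (simp add: list_det_def)
qed

text \<open>Two enumerations of \<open>R\<close> differ by a permutation, and the absolute value
  removes its sign.\<close>

lemma abs_list_det_permute_rows:
  assumes len: "length xs = length ys" and xs: "enumerates xs R" and xs': "enumerates xs' R"
  shows "\<bar>list_det f xs' ys\<bar> = \<bar>list_det f xs ys\<bar>"
proof -
  let ?n = "length ys"
  let ?A = "mat ?n ?n (\<lambda>(i, j). f (xs ! i) (ys ! j))"
  have "mset xs' = mset xs"
    using xs xs' by (metis enumerates_def set_eq_iff_mset_eq_distinct)
  then obtain p where p: "p permutes {..<length xs}" "permute_list p xs = xs'"
    by (rule mset_eq_permutation)
  have p0: "p permutes {0..<?n}"
    using p(1) len by (simp add: atLeast0LessThan)
  have lt: "p i < ?n" if "i < ?n" for i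
    using permutes_in_image[OF p0, of i] that by simp
  have len': "length xs' = ?n"
    using p(2) len by auto
  have nth: "xs' ! i = xs ! p i" if "i < ?n" for i
    using permute_list_nth[OF p(1), of i] p(2) len that by simp
  have "mat (length xs') ?n (\<lambda>(i, j). f (xs' ! i) (ys ! j)) =
      mat ?n ?n (\<lambda>(i, j). ?A $$ (p i, j))"
    by (rule eq_matI) (auto simp: len' nth lt)
  then have "list_det f xs' ys = signof p * det ?A"
    unfolding list_det_def by (simp add: det_permute_rows[OF _ p0])
  then show ?thesis
    by (simp add: list_det_def len abs_mult sign_def)
qed

text \<open>One step of block Gaussian elimination: the matrix is a lower unitriangular matrix times
  an upper block triangular one whose lower right block is the Schur complement of
  \<open>f x y\<close>.\<close>

lemma list_det_pivot:
  assumes len: "length xs = length ys" and nz: "f x y \<noteq> 0"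
  shows "list_det f (x # xs) (y # ys) =
    f x y * list_det (\<lambda>a b. f a b - f a y * f x b / f x y) xs ys"
proof -
  let ?n = "length xs"
  let ?g = "\<lambda>a b. f a b - f a y * f x b / f x y"
  define A1 where "A1 = mat 1 1 (\<lambda>_. f x y)"
  define A2 where "A2 = mat 1 ?n (\<lambda>(_, j). f x (ys ! j))"
  define A3 where "A3 = mat ?n 1 (\<lambda>(i, _). f (xs ! i) y / f x y)"
  define A4 where "A4 = mat ?n ?n (\<lambda>(i, j). ?g (xs ! i) (ys ! j))"
  have car: "A1 \<in> carrier_mat 1 1" "A2 \<in> carrier_mat 1 ?n" "A3 \<in> carrier_mat ?n 1"
    "A4 \<in> carrier_mat ?n ?n"
    by (auto simp: A1_def A2_def A3_def A4_def)
  let ?P = "four_block_mat (1\<^sub>m 1) (0\<^sub>m 1 ?n) A3 (1\<^sub>m ?n)"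
  let ?U = "four_block_mat A1 A2 (0\<^sub>m ?n 1) A4"
  have "?P * ?U = four_block_mat (1\<^sub>m 1 * A1 + 0\<^sub>m 1 ?n * 0\<^sub>m ?n 1) (1\<^sub>m 1 * A2 + 0\<^sub>m 1 ?n * A4)
      (A3 * A1 + 1\<^sub>m ?n * 0\<^sub>m ?n 1) (A3 * A2 + 1\<^sub>m ?n * A4)"
    by (rule mult_four_block_mat) (use car in auto)
  also have "\<dots> = four_block_mat A1 A2 (A3 * A1) (A3 * A2 + A4)"
    using car by simp
  also have "\<dots> = mat (length (x # xs)) (length (y # ys)) (\<lambda>(i, j). f ((x # xs) ! i) ((y # ys) ! j))"
    by (rule eq_matI)
      (auto simp: A1_def A2_def A3_def A4_def len nz nth_Cons' scalar_prod_def)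
  finally have "list_det f (x # xs) (y # ys) = det (?P * ?U)"
    by (simp add: list_det_def)
  also have "\<dots> = det ?P * det ?U"
    by (rule det_mult[of _ "1 + ?n"]) (use car in auto)
  also have "det ?P = 1"
    using car by (subst det_four_block_mat_upper_right_zero[of _ 1 _ ?n]) auto
  also have "det ?U = det A1 * det A4"
    by (rule det_four_block_mat_lower_left_zero[of _ 1 _ ?n]) (use car in auto)
  also have "det A1 = f x y"
    by (simp add: det_single A1_def)
  finally show ?thesis
    by (simp add: list_det_def A4_def len)
qed

lemma list_det_zero_row:
  assumes "length xs = length ys" "x \<in> set xs" "\<And>b. b \<in> set ys \<Longrightarrow> f x b = 0"
  shows "list_det f xs ys = 0"
proof -
  obtain i where i: "i < length xs" "xs ! i = x"
    using assms(2) by (auto simp: in_set_conv_nth)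
  show ?thesis
    unfolding list_det_def
    by (subst laplace_expansion_row[of _ "length xs" i]) (use i assms in auto)
qed

text \<open>
  The absolute value makes the result independent of the two enumerations, provided that \<open>R\<close> and \<open>C\<close>
  are finite and of the same cardinality.
\<close>

definition abs_det :: "('b \<Rightarrow> 'c \<Rightarrow> rat) \<Rightarrow> 'b set \<Rightarrow> 'c set \<Rightarrow> rat" where
  "abs_det f R C = \<bar>list_det f (SOME xs. enumerates xs R) (SOME ys. enumerates ys C)\<bar>"

lemma length_enumerates: "enumerates xs R \<Longrightarrow> length xs = card R"
  by (auto simp: enumerates_def distinct_card)

text \<open>Rows are reordered first; transposing turns the reordering of the columns into one of
  rows.\<close>

lemma abs_det_eq:
  assumes xs: "enumerates xs R" and ys: "enumerates ys C" and card: "card R = card C"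
  shows "abs_det f R C = \<bar>list_det f xs ys\<bar>"
proof -
  define xs' ys' where "xs' = (SOME xs. enumerates xs R)" and "ys' = (SOME ys. enumerates ys C)"
  have xs': "enumerates xs' R" and ys': "enumerates ys' C"
    unfolding xs'_def ys'_def using xs ys by (auto intro: someI)
  note len = length_enumerates[OF xs] length_enumerates[OF ys]
    length_enumerates[OF xs'] length_enumerates[OF ys']
  have "\<bar>list_det f xs' ys'\<bar> = \<bar>list_det f xs ys'\<bar>"
    by (rule abs_list_det_permute_rows[OF _ xs xs']) (simp add: len card)
  also have "\<dots> = \<bar>list_det (\<lambda>b a. f a b) ys' xs\<bar>"
    using list_det_transpose[of xs ys' f] by (simp add: len card)
  also have "\<dots> = \<bar>list_det (\<lambda>b a. f a b) ys xs\<bar>"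
    by (rule abs_list_det_permute_rows[OF _ ys ys']) (simp add: len card)
  also have "\<dots> = \<bar>list_det f xs ys\<bar>"
    using list_det_transpose[of xs ys f] by (simp add: len card)
  finally show ?thesis
    by (simp add: abs_det_def xs'_def ys'_def)
qed

section \<open>Transformation and expansion rules for \<open>abs_det\<close>\<close>

lemma abs_det_cong:
  assumes "finite R" "finite C" "card R = card C" "\<And>a b. a \<in> R \<Longrightarrow> b \<in> C \<Longrightarrow> f a b = g a b"
  shows "abs_det f R C = abs_det g R C"
proof -
  obtain xs ys where e: "enumerates xs R" "enumerates ys C"
    using assms(1,2) ex_enumerates by metis
  have "list_det f xs ys = list_det g xs ys"
    unfolding list_det_def
    by (rule arg_cong[of _ _ det], rule eq_matI) (use e assms(4) in \<open>auto simp: enumerates_def\<close>)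
  then show ?thesis
    by (simp add: abs_det_eq[OF e assms(3)])
qed

lemma abs_det_transpose:
  assumes "finite R" "finite C" "card R = card C"
  shows "abs_det (\<lambda>b a. f a b) C R = abs_det f R C"
proof -
  obtain xs ys where e: "enumerates xs R" "enumerates ys C"
    using assms(1,2) ex_enumerates by metis
  then show ?thesis
    using assms(3) list_det_transpose[of xs ys f]
    by (simp add: abs_det_eq[OF e] abs_det_eq[OF e(2,1)] length_enumerates)
qed

lemma abs_det_image:
  assumes "finite R" "inj_on h R"
  shows "abs_det f (h ` R) (h ` R) = abs_det (\<lambda>a b. f (h a) (h b)) R R"
proof -
  obtain xs where e: "enumerates xs R"
    using assms(1) ex_enumerates by metis
  then have e': "enumerates (map h xs) (h ` R)"
    using assms(2) by (simp add: enumerates_def distinct_map)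
  have "list_det f (map h xs) (map h xs) = list_det (\<lambda>a b. f (h a) (h b)) xs xs"
    unfolding list_det_def by (rule arg_cong[of _ _ det], rule eq_matI) auto
  then show ?thesis
    by (simp add: abs_det_eq[OF e e] abs_det_eq[OF e' e'])
qed

lemma abs_det_uminus:
  assumes "finite R"
  shows "abs_det (\<lambda>a b. - f a b) R R = abs_det f R R"
proof -
  obtain xs where e: "enumerates xs R"
    using assms ex_enumerates by metis
  have "list_det (\<lambda>a b. - f a b) xs xs =
      det ((- 1) \<cdot>\<^sub>m mat (length xs) (length xs) (\<lambda>(i, j). f (xs ! i) (xs ! j)))"
    unfolding list_det_def by (rule arg_cong[of _ _ det], rule eq_matI) auto
  also have "\<dots> = (- 1) ^ length xs * list_det f xs xs"
    by (simp add: list_det_def)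
  finally show ?thesis
    by (simp add: abs_det_eq[OF e e] abs_mult power_abs)
qed

lemma abs_det_empty [simp]: "abs_det f {} {} = 1"
proof -
  have e: "enumerates [] {}"
    by (simp add: enumerates_def)
  show ?thesis
    by (simp add: abs_det_eq[OF e e] list_det_def)
qed

lemma abs_det_singleton: "abs_det f {v} {v} = \<bar>f v v\<bar>"
proof -
  have "enumerates [v] {v}"
    by (simp add: enumerates_def)
  then show ?thesis
    by (simp add: abs_det_eq list_det_def det_single)
qed

lemma abs_det_pivot:
  assumes fin: "finite R" "finite C" and card: "card R = card C"
    and mem: "x \<in> R" "y \<in> C" and nz: "f x y \<noteq> 0"
  shows "abs_det f R C =
    \<bar>f x y\<bar> * abs_det (\<lambda>a b. f a b - f a y * f x b / f x y) (R - {x}) (C - {y})"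
proof -
  have "finite (R - {x})" "finite (C - {y})"
    using fin by auto
  then obtain xs ys where e: "enumerates xs (R - {x})" "enumerates ys (C - {y})"
    using ex_enumerates by metis
  then have e': "enumerates (x # xs) R" "enumerates (y # ys) C"
    using mem by (auto simp: enumerates_def)
  have "card (R - {x}) = card (C - {y})"
    using fin mem card by simp
  then have len: "length xs = length ys"
    using e by (simp add: length_enumerates)
  show ?thesis
    by (simp add: abs_det_eq[OF e' card] abs_det_eq[OF e \<open>card (R - {x}) = card (C - {y})\<close>]
        list_det_pivot[OF len, of f, OF nz] abs_mult)
qed

lemma abs_det_zero_row:
  assumes "finite R" "finite C" "card R = card C" "x \<in> R" "\<And>b. b \<in> C \<Longrightarrow> f x b = 0"
  shows "abs_det f R C = 0"
proof -
  obtain xs ys where e: "enumerates xs R" "enumerates ys C"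
    using assms(1,2) ex_enumerates by metis
  have "list_det f xs ys = 0"
    by (rule list_det_zero_row[of _ _ x]) (use e assms in \<open>auto simp: enumerates_def distinct_card\<close>)
  then show ?thesis
    by (simp add: abs_det_eq[OF e assms(3)])
qed

lemma abs_det_zero_col:
  assumes "finite R" "finite C" "card R = card C" "y \<in> C" "\<And>a. a \<in> R \<Longrightarrow> f a y = 0"
  shows "abs_det f R C = 0"
  using abs_det_zero_row[of C R y "\<lambda>b a. f a b"] abs_det_transpose[of R C f] assms by metis

text \<open>Pivoting at \<open>f x y\<close> corrects the entry at \<open>a\<close>,
  \<open>b\<close> by a multiple of \<open>f x b\<close>, which is zero for every remaining column
  \<open>b\<close>.\<close>

lemma abs_det_single_row:
  assumes "finite R" "finite C" "card R = card C" "x \<in> R" "y \<in> C" "\<bar>f x y\<bar> = 1"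
    "\<And>b. b \<in> C \<Longrightarrow> b \<noteq> y \<Longrightarrow> f x b = 0"
  shows "abs_det f R C = abs_det f (R - {x}) (C - {y})"
proof -
  have "abs_det f R C =
      \<bar>f x y\<bar> * abs_det (\<lambda>a b. f a b - f a y * f x b / f x y) (R - {x}) (C - {y})"
    by (rule abs_det_pivot) (use assms in auto)
  also have "\<dots> = abs_det f (R - {x}) (C - {y})"
    unfolding assms(6) mult_1 by (rule abs_det_cong) (use assms in auto)
  finally show ?thesis .
qed

lemma abs_det_single_col:
  assumes "finite R" "finite C" "card R = card C" "x \<in> R" "y \<in> C" "\<bar>f x y\<bar> = 1"
    "\<And>a. a \<in> R \<Longrightarrow> a \<noteq> x \<Longrightarrow> f a y = 0"
  shows "abs_det f R C = abs_det f (R - {x}) (C - {y})"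
proof -
  have "abs_det (\<lambda>b a. f a b) C R = abs_det (\<lambda>b a. f a b) (C - {y}) (R - {x})"
    by (rule abs_det_single_row) (use assms in auto)
  moreover have "card (R - {x}) = card (C - {y})"
    using assms by simp
  ultimately show ?thesis
    using assms(1-3) abs_det_transpose[of R C f] abs_det_transpose[of "R - {x}" "C - {y}" f] by simp
qed

text \<open>The elements of \<open>E\<close> can be eliminated one at a time. Since \<open>f\<close>
  is the identity on \<open>E\<close>, pivoting at \<open>x\<close> changes no entry whose row or
  column lies in the rest of \<open>E\<close>, and the corrections on \<open>S\<close> add up to the
  sum.\<close>

lemma abs_det_schur:
  assumes "finite E" "finite S" "S \<inter> E = {}"
    "\<And>e e'. e \<in> E \<Longrightarrow> e' \<in> E \<Longrightarrow> f e e' = (if e = e' then 1 else 0)"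
  shows "abs_det f (S \<union> E) (S \<union> E) = abs_det (\<lambda>a b. f a b - (\<Sum>e\<in>E. f a e * f e b)) S S"
  using assms
proof (induction E arbitrary: f rule: finite_induct)
  case empty
  then show ?case by simp
next
  case (insert x E)
  let ?g = "\<lambda>a b. f a b - f a x * f x b"
  have fx: "f x x = 1" "\<And>e. e \<in> E \<Longrightarrow> f x e = 0" "\<And>e. e \<in> E \<Longrightarrow> f e x = 0"
    using insert.prems(3) insert.hyps(2) by auto
  have "S \<union> insert x E - {x} = S \<union> E"
    using insert.prems(2) insert.hyps(2) by auto
  then have "abs_det f (S \<union> insert x E) (S \<union> insert x E) = abs_det ?g (S \<union> E) (S \<union> E)"
    using abs_det_pivot[of "S \<union> insert x E" "S \<union> insert x E" x x f] insert fx by simp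
  also have "\<dots> = abs_det (\<lambda>a b. ?g a b - (\<Sum>e\<in>E. ?g a e * ?g e b)) S S"
    by (rule insert.IH) (use insert fx in auto)
  also have "(\<lambda>a b. ?g a b - (\<Sum>e\<in>E. ?g a e * ?g e b)) =
      (\<lambda>a b. f a b - (\<Sum>e\<in>insert x E. f a e * f e b))"
    using insert.hyps fx by (auto simp: fun_eq_iff algebra_simps intro!: sum.cong)
  finally show ?case .
qed

section \<open>Minors of forests\<close>

text \<open>The test \<open>a = b\<close> comes first, so a reflexive relation such as
  \<open>incident\<close> can serve as \<open>adj\<close>: the diagonal is always given by
  \<open>d\<close>.\<close>

definition weighted_adj :: "('b \<Rightarrow> 'b \<Rightarrow> bool) \<Rightarrow> ('b \<Rightarrow> rat) \<Rightarrow> 'b \<Rightarrow> 'b \<Rightarrow> rat" where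
  "weighted_adj adj d a b = (if a = b then d a else if adj a b then 1 else 0)"

text \<open>
  The diagonal weights are arbitrary because eliminating a leaf \<open>l\<close> with \<open>d l \<noteq> 0\<close> leaves a matrix of
  the same kind in which only the weight of the neighbour \<open>p\<close> of \<open>l\<close> has changed. The new weight does
  not depend on the rows and columns chosen, so a principal minor found for the smaller matrix
  lifts by adding \<open>l\<close> back. If \<open>d l = 0\<close>, then \<open>l\<close> and \<open>p\<close> are removed and added back together.
\<close>

lemma abs_det_eq_principal:
  assumes sym: "\<And>a b. adj a b \<Longrightarrow> adj b a"
    and leaf: "\<And>W. finite W \<Longrightarrow> W \<noteq> {} \<Longrightarrow> W \<subseteq> U \<Longrightarrow>
      \<exists>l\<in>W. \<exists>p. \<forall>b\<in>W. b \<noteq> l \<longrightarrow> adj l b \<longrightarrow> b = p"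
    and fin: "finite R" "finite C" and card: "card R = card C" and sub: "R \<union> C \<subseteq> U"
  shows "abs_det (weighted_adj adj d) R C = 0 \<or>
    (\<exists>S\<subseteq>R \<union> C. abs_det (weighted_adj adj d) R C = abs_det (weighted_adj adj d) S S)"
  using fin card sub
proof (induction "card (R \<union> C)" arbitrary: R C d rule: less_induct)
  case less
  let ?W = "R \<union> C" and ?F = "weighted_adj adj d"
  have finW: "finite ?W"
    using less.prems by simp
  show ?case
  proof (cases "?W = {}")
    case True
    then show ?thesis by auto
  next
    case False
    \<comment> \<open>The element \<open>p\<close> may lie outside \<open>R \<union> C\<close> or
      coincide with \<open>l\<close> if \<open>l\<close> has no other neighbour there; the cases
      below therefore test for it.\<close>
    then obtain l p where l: "l \<in> ?W" and p: "\<And>b. b \<in> ?W \<Longrightarrow> b \<noteq> l \<Longrightarrow> adj l b \<Longrightarrow> b = p"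
      using leaf[OF finW] less.prems(4) by metis
    have p': "b = p" if "b \<in> ?W" "b \<noteq> l" "adj b l" for b
      using p sym that by blast
    have smaller: "card (R' \<union> C') < card ?W" if "R' \<subseteq> R" "C' \<subseteq> C" "l \<notin> R' \<union> C'" for R' C'
    proof (rule psubset_card_mono[OF finW])
      show "R' \<union> C' \<subset> ?W"
        using that l by blast
    qed
    have row: "?F l b = 0" if "b \<in> ?W" "b \<noteq> l" "b \<noteq> p" for b
      using that p by (auto simp: weighted_adj_def)
    have col: "?F a l = 0" if "a \<in> ?W" "a \<noteq> l" "a \<noteq> p" for a
      using that p' by (auto simp: weighted_adj_def)
    consider (R) "l \<in> R" "l \<notin> C" | (C) "l \<notin> R" "l \<in> C"
      | (pivot) "l \<in> R" "l \<in> C" "d l \<noteq> 0" | (swap) "l \<in> R" "l \<in> C" "d l = 0"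
      using l by blast
    then show ?thesis
    proof cases
      \<comment> \<open>Column \<open>l\<close> is absent, so row \<open>l\<close> can be nonzero
        only in column \<open>p\<close>. Either the row is zero, or expanding along it removes
        \<open>l\<close> altogether. The next case is the mirror image.\<close>
      case R
      show ?thesis
      proof (cases "p \<in> C \<and> adj l p")
        case True
        have eq: "abs_det ?F R C = abs_det ?F (R - {l}) (C - {p})"
        proof (rule abs_det_single_row)
          show "\<bar>?F l p\<bar> = 1"
            using True R by (auto simp: weighted_adj_def)
          show "?F l b = 0" if "b \<in> C" "b \<noteq> p" for b
            using that R row by auto
        qed (use less.prems R True in auto)
        have "abs_det ?F (R - {l}) (C - {p}) = 0 \<or>
            (\<exists>S\<subseteq>(R - {l}) \<union> (C - {p}). abs_det ?F (R - {l}) (C - {p}) = abs_det ?F S S)"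
          by (rule less.hyps) (use less.prems True R in \<open>auto intro!: smaller\<close>)
        with eq show ?thesis
          by auto
      next
        case False
        have "abs_det ?F R C = 0"
        proof (rule abs_det_zero_row[of _ _ l])
          show "?F l b = 0" if "b \<in> C" for b
            using False R p that by (auto simp: weighted_adj_def)
        qed (use less.prems R in auto)
        then show ?thesis ..
      qed
    next
      case C
      show ?thesis
      proof (cases "p \<in> R \<and> adj l p")
        case True
        have eq: "abs_det ?F R C = abs_det ?F (R - {p}) (C - {l})"
        proof (rule abs_det_single_col)
          show "\<bar>?F p l\<bar> = 1"
            using True C sym by (auto simp: weighted_adj_def)
          show "?F a l = 0" if "a \<in> R" "a \<noteq> p" for a
            using that C col by auto
        qed (use less.prems C True in auto)
        have "abs_det ?F (R - {p}) (C - {l}) = 0 \<or>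
            (\<exists>S\<subseteq>(R - {p}) \<union> (C - {l}). abs_det ?F (R - {p}) (C - {l}) = abs_det ?F S S)"
          by (rule less.hyps) (use less.prems True C in \<open>auto intro!: smaller\<close>)
        with eq show ?thesis
          by auto
      next
        case False
        have "abs_det ?F R C = 0"
        proof (rule abs_det_zero_col[of _ _ l])
          show "?F a l = 0" if "a \<in> R" for a
            using False C p' sym that by (auto simp: weighted_adj_def)
        qed (use less.prems C in auto)
        then show ?thesis ..
      qed
    next
      case pivot
      \<comment> \<open>Among the entries that survive the pivot at \<open>l\<close>, only the
        diagonal entry at \<open>p\<close> can change, because row and column \<open>l\<close>
        vanish at all other surviving places.\<close>
      define d' where "d' = d(p := d p - (if adj l p then 1 else 0) / d l)"
      \<comment> \<open>Stated for arbitrary \<open>R'\<close> and \<open>C'\<close>: the identity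
        is used once to shrink \<open>R\<close>, \<open>C\<close> and once, backwards, to lift
        \<open>S\<close> to \<open>insert l S\<close>.\<close>
      have piv: "abs_det ?F R' C' =
          \<bar>d l\<bar> * abs_det (weighted_adj adj d') (R' - {l}) (C' - {l})"
        if sub': "R' \<subseteq> ?W" "C' \<subseteq> ?W" and l': "l \<in> R'" "l \<in> C'" and card': "card R' = card C'"
        for R' C'
      proof -
        have fin': "finite R'" "finite C'"
          using sub' finW by (auto dest: finite_subset)
        have Fll: "?F l l = d l"
          by (simp add: weighted_adj_def)
        have "abs_det ?F R' C' =
            \<bar>?F l l\<bar> * abs_det (\<lambda>a b. ?F a b - ?F a l * ?F l b / ?F l l) (R' - {l}) (C' - {l})"
          by (rule abs_det_pivot) (use fin' card' l' Fll pivot in auto)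
        also have "abs_det (\<lambda>a b. ?F a b - ?F a l * ?F l b / ?F l l) (R' - {l}) (C' - {l}) =
            abs_det (weighted_adj adj d') (R' - {l}) (C' - {l})"
        proof (rule abs_det_cong)
          fix a b assume ab: "a \<in> R' - {l}" "b \<in> C' - {l}"
          then have abW: "a \<in> ?W" "b \<in> ?W" "a \<noteq> l" "b \<noteq> l"
            using sub' by auto
          show "?F a b - ?F a l * ?F l b / ?F l l = weighted_adj adj d' a b"
          proof (cases "a = p \<and> b = p")
            case True
            then show ?thesis
              using abW sym by (auto simp: weighted_adj_def d'_def)
          next
            case False
            then have "?F a l * ?F l b = 0"
              using row[of b] col[of a] abW by auto
            with False show ?thesis
              by (auto simp: weighted_adj_def d'_def)
          qed
        qed (use fin' card' l' in auto)
        finally show ?thesis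
          by (simp add: Fll)
      qed
      let ?F' = "weighted_adj adj d'"
      have "abs_det ?F' (R - {l}) (C - {l}) = 0 \<or>
          (\<exists>S\<subseteq>(R - {l}) \<union> (C - {l}). abs_det ?F' (R - {l}) (C - {l}) = abs_det ?F' S S)"
        by (rule less.hyps) (use less.prems pivot in \<open>auto intro!: smaller\<close>)
      then show ?thesis
      proof
        assume "abs_det ?F' (R - {l}) (C - {l}) = 0"
        then show ?thesis
          using piv[of R C] pivot less.prems by simp
      next
        assume "\<exists>S\<subseteq>(R - {l}) \<union> (C - {l}). abs_det ?F' (R - {l}) (C - {l}) = abs_det ?F' S S"
        then obtain S where S: "S \<subseteq> (R - {l}) \<union> (C - {l})"
          "abs_det ?F' (R - {l}) (C - {l}) = abs_det ?F' S S"
          by blast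
        then have "insert l S - {l} = S" "insert l S \<subseteq> ?W"
          using l by auto
        then have "abs_det ?F R C = abs_det ?F (insert l S) (insert l S)"
          using piv[of R C] piv[of "insert l S" "insert l S"] pivot less.prems S(2) by simp
        with \<open>insert l S \<subseteq> ?W\<close> show ?thesis
          by blast
      qed
    next
      case swap
      \<comment> \<open>As \<open>d l = 0\<close>, the only nonzero entry of row \<open>l\<close>,
        and likewise of column \<open>l\<close>, is the one at \<open>p\<close>. Expanding along
        both removes \<open>l\<close> and \<open>p\<close> from rows and columns.\<close>
      have swp: "abs_det ?F R' C' = abs_det ?F (R' - {l, p}) (C' - {l, p})"
        if sub': "R' \<subseteq> ?W" "C' \<subseteq> ?W" and mem: "l \<in> R'" "l \<in> C'" "p \<in> R'" "p \<in> C'"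
          and card': "card R' = card C'" and lp: "p \<noteq> l" "adj l p"
        for R' C'
      proof -
        have fin': "finite R'" "finite C'"
          using sub' finW by (auto dest: finite_subset)
        have "abs_det ?F R' C' = abs_det ?F (R' - {l}) (C' - {p})"
        proof (rule abs_det_single_row)
          show "\<bar>?F l p\<bar> = 1"
            using lp by (auto simp: weighted_adj_def)
          show "?F l b = 0" if "b \<in> C'" "b \<noteq> p" for b
            using that row[of b] sub' swap by (cases "b = l") (auto simp: weighted_adj_def)
        qed (use fin' card' mem in auto)
        also have "\<dots> = abs_det ?F (R' - {l} - {p}) (C' - {p} - {l})"
        proof (rule abs_det_single_col)
          show "\<bar>?F p l\<bar> = 1"
            using lp sym by (auto simp: weighted_adj_def)
          show "?F a l = 0" if "a \<in> R' - {l}" "a \<noteq> p" for a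
            using that col[of a] sub' by auto
        qed (use fin' card' mem lp in auto)
        also have "R' - {l} - {p} = R' - {l, p}"
          by auto
        also have "C' - {p} - {l} = C' - {l, p}"
          by auto
        finally show ?thesis .
      qed
      \<comment> \<open>Since \<open>d l = 0\<close>, row \<open>l\<close> vanishes on
        \<open>C\<close> unless \<open>p\<close> is a neighbour lying in \<open>C\<close>; the same
        holds for column \<open>l\<close> and \<open>R\<close>.\<close>
      consider (both) "p \<noteq> l" "adj l p" "p \<in> R" "p \<in> C" | (zrow) "\<And>b. b \<in> C \<Longrightarrow> ?F l b = 0"
        | (zcol) "\<And>a. a \<in> R \<Longrightarrow> ?F a l = 0"
      proof (cases "p \<noteq> l \<and> adj l p")
        case True
        have Fll: "?F l l = 0"
          using swap by (simp add: weighted_adj_def)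
        have "?F l b = 0" if "b \<in> C" "p \<notin> C" for b
          using that row[of b] Fll by (metis UnI2)
        moreover have "?F a l = 0" if "a \<in> R" "p \<notin> R" for a
          using that col[of a] Fll by (metis UnI1)
        ultimately show ?thesis
          using that True by blast
      next
        case False
        then have "?F l b = 0" if "b \<in> C" for b
          using that p[of b] swap by (auto simp: weighted_adj_def)
        with that show ?thesis
          by blast
      qed
      then show ?thesis
      proof cases
        case both
        have "card (R - {l, p}) = card (C - {l, p})"
          using both swap less.prems by (simp add: card_Diff_subset)
        then have "abs_det ?F (R - {l, p}) (C - {l, p}) = 0 \<or>
            (\<exists>S\<subseteq>(R - {l, p}) \<union> (C - {l, p}). abs_det ?F (R - {l, p}) (C - {l, p}) = abs_det ?F S S)"
          by (intro less.hyps smaller) (use less.prems both swap in auto)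
        then show ?thesis
        proof
          assume "abs_det ?F (R - {l, p}) (C - {l, p}) = 0"
          then show ?thesis
            using swp[of R C] swap both less.prems by simp
        next
          assume "\<exists>S\<subseteq>(R - {l, p}) \<union> (C - {l, p}). abs_det ?F (R - {l, p}) (C - {l, p}) = abs_det ?F S S"
          then obtain S where S: "S \<subseteq> (R - {l, p}) \<union> (C - {l, p})"
            "abs_det ?F (R - {l, p}) (C - {l, p}) = abs_det ?F S S"
            by blast
          let ?S = "insert l (insert p S)"
          have "?S - {l, p} = S" "?S \<subseteq> ?W"
            using S(1) both swap by auto
          then have "abs_det ?F R C = abs_det ?F ?S ?S"
            using swp[of R C] swp[of ?S ?S] swap both less.prems S(2) by simp
          with \<open>?S \<subseteq> ?W\<close> show ?thesis
            by blast
        qed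
      next
        case zrow
        have "abs_det ?F R C = 0"
          by (rule abs_det_zero_row[of _ _ l]) (use zrow less.prems swap in auto)
        then show ?thesis ..
      next
        case zcol
        have "abs_det ?F R C = 0"
          by (rule abs_det_zero_col[of _ _ l]) (use zcol less.prems swap in auto)
        then show ?thesis ..
      qed
    qed
  qed
qed

section \<open>Leaves of forests and of their incidence structure\<close>

text \<open>If all degrees were at least two, the first vertex of a longest path would have a
  neighbour other than the second vertex. By maximality that neighbour lies on the path, which
  closes a cycle.\<close>

lemma forest_has_leaf:
  assumes "forest G" "verts G \<noteq> {}"
  shows "\<exists>v\<in>verts G. vdegree G v \<le> 1"
proof (rule ccontr)
  assume "\<not> ?thesis"
  then have deg: "1 < card {e \<in> edges G. v \<in> e}" if "v \<in> verts G" for v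
    using that by (auto simp: vdegree_def not_le)
  have G: "finite (verts G)" "\<And>e. e \<in> edges G \<Longrightarrow> e \<subseteq> verts G \<and> card e = 2"
    and acyclic: "\<And>vs. \<not> is_cycle G vs"
    using assms(1) by (auto simp: forest_def simple_graph_def)
  define is_path where "is_path vs \<longleftrightarrow> vs \<noteq> [] \<and> distinct vs \<and> set vs \<subseteq> verts G \<and>
    (\<forall>i. Suc i < length vs \<longrightarrow> {vs ! i, vs ! Suc i} \<in> edges G)" for vs
  obtain v0 where "v0 \<in> verts G"
    using assms(2) by blast
  then have "is_path [v0]"
    by (simp add: is_path_def)
  \<comment> \<open>Distinctness bounds the length of a path by the number of vertices, so a longest
    path exists.\<close>
  moreover have "length vs < Suc (card (verts G))" if "is_path vs" for vs
    using that G(1) by (metis card_mono distinct_card is_path_def le_imp_less_Suc)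
  ultimately obtain vs where vs: "is_path vs" and longest: "\<And>us. is_path us \<Longrightarrow> length us \<le> length vs"
    using ex_has_greatest_nat[of is_path "[v0]" length "Suc (card (verts G))"] by blast
  define v where "v = vs ! 0"
  have v: "v \<in> verts G" "v \<in> set vs" "vs \<noteq> []"
    using vs by (auto simp: is_path_def v_def)
  \<comment> \<open>For a path with one vertex, \<open>vs ! 1\<close> is unspecified. This is
    harmless: two edges at \<open>v\<close> give two distinct neighbours, and one of them avoids any
    prescribed value.\<close>
  have "\<exists>w. w \<noteq> v \<and> {v, w} \<in> edges G \<and> w \<noteq> vs ! 1"
  proof -
    have finE: "finite {e \<in> edges G. v \<in> e}"
      using assms(1) by (simp add: forest_def finite_edges)
    obtain e e' where e: "e \<in> edges G" "v \<in> e" "e' \<in> edges G" "v \<in> e'" "e \<noteq> e'"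
      using deg[OF v(1)] card_le_Suc0_iff_eq[of "{e \<in> edges G. v \<in> e}"] finE by auto
    have "\<exists>w. w \<noteq> v \<and> x = {v, w}" if "x \<in> edges G" "v \<in> x" for x
      using G(2)[OF that(1)] that(2) by (auto simp: card_2_iff)
    then obtain w w' where "w \<noteq> v" "e = {v, w}" "w' \<noteq> v" "e' = {v, w'}"
      using e by meson
    with e show ?thesis
      by metis
  qed
  then obtain w where w: "w \<noteq> v" "{v, w} \<in> edges G" "w \<noteq> vs ! 1"
    by blast
  have "w \<in> set vs"
  proof (rule ccontr)
    assume "w \<notin> set vs"
    have "is_path (w # vs)"
      unfolding is_path_def
    proof (intro conjI allI impI)
      show "distinct (w # vs)" "set (w # vs) \<subseteq> verts G"
        using vs \<open>w \<notin> set vs\<close> G(2)[OF w(2)] by (auto simp: is_path_def)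
      fix i assume i: "Suc i < length (w # vs)"
      show "{(w # vs) ! i, (w # vs) ! Suc i} \<in> edges G"
        using i vs w(2) by (cases i) (auto simp: is_path_def v_def insert_commute)
    qed simp
    then show False
      using longest[of "w # vs"] by simp
  qed
  then obtain k where k: "k < length vs" "w = vs ! k"
    by (auto simp: in_set_conv_nth)
  have "k \<noteq> 0" "k \<noteq> 1"
    using k w by (metis v_def)+
  \<comment> \<open>The segment from \<open>v\<close> to \<open>w\<close>, closed by the edge
    between them; as \<open>k\<close> is at least 2, it has at least three vertices.\<close>
  let ?c = "take (Suc k) vs"
  have len: "length ?c = Suc k"
    using k by simp
  have "is_cycle G ?c"
    unfolding is_cycle_def len
  proof (intro conjI allI impI)
    show "3 \<le> Suc k"
      using \<open>k \<noteq> 0\<close> \<open>k \<noteq> 1\<close> by simp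
    show "distinct ?c"
      using vs by (simp add: is_path_def)
    fix i assume i: "i < Suc k"
    show "{?c ! i, ?c ! (Suc i mod Suc k)} \<in> edges G"
    proof (cases "i = k")
      case True
      then show ?thesis
        using w(2) k by (simp add: v_def insert_commute)
    next
      case False
      then show ?thesis
        using i vs k by (simp add: is_path_def)
    qed
  qed
  with acyclic show False
    by blast
qed

lemma incident_sym: "incident a b \<Longrightarrow> incident b a"
  by (auto simp: incident_def)

lemma incident_simps [simp]:
  "incident (Inl u) (Inl v) \<longleftrightarrow> u = v"
  "incident (Inr e) (Inr e') \<longleftrightarrow> e = e'"
  "incident (Inl v) (Inr e) \<longleftrightarrow> v \<in> e"
  "incident (Inr e) (Inl v) \<longleftrightarrow> v \<in> e"
  by (auto simp: incident_def)

text \<open>This is the leaf property of the subdivision of \<open>G\<close>, obtained without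
  constructing it. An edge in \<open>W\<close> that lacks an endpoint in \<open>W\<close> is itself
  a leaf. Otherwise \<open>W\<close> consists of the vertices and edges of a subgraph, and a vertex
  of degree at most one in that forest is a leaf.\<close>

lemma elements_have_leaf:
  assumes G: "forest G" and W: "finite W" "W \<noteq> {}" "W \<subseteq> elements G"
  shows "\<exists>l\<in>W. \<exists>p. \<forall>b\<in>W. b \<noteq> l \<longrightarrow> incident l b \<longrightarrow> b = p"
proof (cases "\<exists>e. Inr e \<in> W \<and> \<not> Inl ` e \<subseteq> W")
  case True
  then obtain e u where e: "Inr e \<in> W" "u \<in> e" "Inl u \<notin> W"
    by auto
  then have "card e = 2"
    using G W(3) by (auto simp: elements_def forest_def simple_graph_def)
  then obtain v where "e = {u, v}"
    using e(2) by (auto simp: card_2_iff)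
  then have "b = Inl v" if "b \<in> W" "b \<noteq> Inr e" "incident (Inr e) b" for b
    using that e(3) by (cases b) auto
  with e(1) show ?thesis
    by blast
next
  case False
  define H where "H = \<lparr>verts = {v. Inl v \<in> W}, edges = {e. Inr e \<in> W}\<rparr>"
  have simple: "simple_graph G"
    using G by (simp add: forest_def)
  have sub: "verts H \<subseteq> verts G" "edges H \<subseteq> edges G"
    using W(3) by (auto simp: H_def elements_def)
  have "subgraph H G"
    unfolding subgraph_def simple_graph_def
  proof (intro conjI ballI)
    show "finite (verts H)"
      using sub(1) simple by (auto simp: simple_graph_def dest: finite_subset)
    show "e \<subseteq> verts H" if "e \<in> edges H" for e
      using that False by (auto simp: H_def)
    show "card e = 2" if "e \<in> edges H" for e
      using that sub(2) simple by (auto simp: simple_graph_def)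
  qed (use sub in auto)
  then have H: "forest H"
    using G by (rule subgraph_forest)
  have "verts H \<noteq> {}"
  proof
    assume empty: "verts H = {}"
    obtain x where x: "x \<in> W"
      using W(2) by blast
    with empty obtain e where "x = Inr e"
      by (cases x) (auto simp: H_def)
    with x have "e \<in> edges H"
      by (simp add: H_def)
    then have "e \<subseteq> verts H" "card e = 2"
      using H by (auto simp: forest_def simple_graph_def)
    with empty show False
      by auto
  qed
  then obtain v where v: "v \<in> verts H" "vdegree H v \<le> 1"
    using forest_has_leaf[OF H] by blast
  have "finite (edges H)"
    using H by (simp add: forest_def finite_edges)
  then have "\<forall>e\<in>{e \<in> edges H. v \<in> e}. \<forall>e'\<in>{e \<in> edges H. v \<in> e}. e = e'"
    using v(2) card_le_Suc0_iff_eq[of "{e \<in> edges H. v \<in> e}"] by (simp add: vdegree_def)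
  then obtain e0 where "\<And>e. e \<in> edges H \<Longrightarrow> v \<in> e \<Longrightarrow> e = e0"
    by blast
  then have "b = Inr e0" if "b \<in> W" "b \<noteq> Inl v" "incident (Inl v) b" for b
    using that by (cases b) (auto simp: H_def)
  moreover have "Inl v \<in> W"
    using v(1) by (simp add: H_def)
  ultimately show ?thesis
    by blast
qed

section \<open>Minors of the incidence matrix\<close>

definition incidence :: "'a + 'a set \<Rightarrow> 'a + 'a set \<Rightarrow> rat" where
  "incidence \<alpha> \<beta> = (if incident \<alpha> \<beta> then 1 else 0)"

text \<open>Between vertices of \<open>G''\<close> the edges of the induced subgraph are those of
  \<open>G'\<close>. Hence a nested pair enters only through the edge set \<open>E\<close> of
  \<open>G'\<close> and the vertex set \<open>S\<close> of \<open>G''\<close>.\<close>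

definition ltilde_entry :: "'a set set \<Rightarrow> 'a \<Rightarrow> 'a \<Rightarrow> rat" where
  "ltilde_entry E u v = (if {u, v} \<in> E then 1 else 0) +
     (if u = v then of_nat (card {e \<in> E. u \<in> e}) - 1 else 0)"

lemma minor_eq_principal:
  assumes G: "forest G" and sub: "R \<subseteq> elements G" "C \<subseteq> elements G" and card: "card R = card C"
  shows "abs_det incidence R C = 0 \<or>
    (\<exists>S\<subseteq>elements G. abs_det incidence R C = abs_det incidence S S)"
proof -
  have "finite (elements G)"
    using G by (simp add: elements_def forest_def finite_edges simple_graph_def)
  then have fin: "finite R" "finite C"
    using sub by (auto dest: finite_subset)
  \<comment> \<open>Every element is incident with itself, so all diagonal weights are 1.\<close>
  have eq: "incidence = weighted_adj incident (\<lambda>_. 1)"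
    by (auto simp: fun_eq_iff incidence_def weighted_adj_def incident_def)
  have "abs_det incidence R C = 0 \<or> (\<exists>S\<subseteq>R \<union> C. abs_det incidence R C = abs_det incidence S S)"
    unfolding eq
    by (rule abs_det_eq_principal[where U = "elements G"])
      (use incident_sym elements_have_leaf[OF G] fin card sub in blast)+
  then show ?thesis
    using sub by blast
qed

text \<open>The block on \<open>E\<close> is the identity, and its Schur complement at
  \<open>a\<close>, \<open>b\<close> subtracts the number of edges containing both vertices: the
  degree if \<open>a = b\<close>, otherwise 1 or 0. Edges of \<open>E\<close> with an endpoint
  outside \<open>S\<close> still count towards degrees.\<close>

lemma principal_minor_eq_ltilde:
  assumes "finite S" "finite E" and two: "\<And>e. e \<in> E \<Longrightarrow> card e = 2"
  shows "abs_det incidence (Inl ` S \<union> Inr ` E) (Inl ` S \<union> Inr ` E) = abs_det (ltilde_entry E) S S"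
proof -
  let ?g = "\<lambda>\<alpha> \<beta>. incidence \<alpha> \<beta> - (\<Sum>\<epsilon>\<in>Inr ` E. incidence \<alpha> \<epsilon> * incidence \<epsilon> \<beta>)"
  have g: "?g (Inl a) (Inl b) = - ltilde_entry E a b" for a b
  proof -
    have "(\<Sum>\<epsilon>\<in>Inr ` E. incidence (Inl a) \<epsilon> * incidence \<epsilon> (Inl b)) =
        (\<Sum>e\<in>E. if a \<in> e \<and> b \<in> e then 1 else 0)"
      by (subst sum.reindex) (auto simp: incidence_def intro!: sum.cong)
    also have "\<dots> = of_nat (card {e \<in> E. a \<in> e \<and> b \<in> e})"
      using assms(2) by (simp add: sum.If_cases Int_def)
    finally have sum: "(\<Sum>\<epsilon>\<in>Inr ` E. incidence (Inl a) \<epsilon> * incidence \<epsilon> (Inl b)) =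
        of_nat (card {e \<in> E. a \<in> e \<and> b \<in> e})" .
    show ?thesis
    proof (cases "a = b")
      case True
      \<comment> \<open>On the diagonal the adjacency term of \<open>ltilde_entry\<close> asks for
        the set \<open>{a}\<close>, which is no edge.\<close>
      have "{a} \<notin> E"
        using two[of "{a}"] by auto
      then show ?thesis
        unfolding sum using True by (simp add: incidence_def ltilde_entry_def)
    next
      case False
      have "e = {a, b}" if "e \<in> E" "a \<in> e" "b \<in> e" for e
        using two[OF that(1)] that(2,3) False by (auto simp: card_2_iff)
      then have "{e \<in> E. a \<in> e \<and> b \<in> e} = {{a, b}} \<inter> E"
        by blast
      then show ?thesis
        unfolding sum using False by (simp add: incidence_def ltilde_entry_def Int_insert_left)
    qed
  qed
  have "abs_det incidence (Inl ` S \<union> Inr ` E) (Inl ` S \<union> Inr ` E) = abs_det ?g (Inl ` S) (Inl ` S)"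
    by (rule abs_det_schur) (use assms in \<open>auto simp: incidence_def\<close>)
  also have "\<dots> = abs_det (\<lambda>a b. ?g (Inl a) (Inl b)) S S"
    by (rule abs_det_image) (use assms in auto)
  also have "\<dots> = abs_det (\<lambda>a b. - ltilde_entry E a b) S S"
    by (simp only: g)
  also have "\<dots> = abs_det (ltilde_entry E) S S"
    by (rule abs_det_uminus[OF assms(1)])
  finally show ?thesis .
qed

section \<open>Translation between integer matrices and \<open>abs_det\<close>\<close>

lemma of_int_abs_det_mat:
  fixes h :: "nat \<Rightarrow> nat \<Rightarrow> int"
  assumes "\<And>i j. i < length xs \<Longrightarrow> j < length ys \<Longrightarrow> of_int (h i j) = f (xs ! i) (ys ! j)"
    and "enumerates xs R" "enumerates ys C" "card R = card C"
  shows "of_int \<bar>det (mat (length xs) (length ys) (\<lambda>(i, j). h i j))\<bar> = abs_det f R C"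
proof -
  let ?A = "mat (length xs) (length ys) (\<lambda>(i, j). h i j)"
  have "map_mat of_int ?A = mat (length xs) (length ys) (\<lambda>(i, j). f (xs ! i) (ys ! j))"
    by (rule eq_matI) (auto simp: assms(1))
  then have "list_det f xs ys = of_int (det ?A)"
    unfolding list_det_def by (metis of_int_hom.hom_det)
  then show ?thesis
    by (simp add: abs_det_eq[OF assms(2-4)])
qed

lemma abs_det_Ltilde:
  assumes "simple_graph G'" "induced_subgraph G'' G'" and vs: "enumerates vs (verts G'')"
  shows "of_int \<bar>det (Ltilde G' G'' vs)\<bar> =
    abs_det (ltilde_entry (edges G')) (verts G'') (verts G'')"
proof -
  let ?h = "\<lambda>i j. (if {vs ! i, vs ! j} \<in> edges G'' then 1 else 0) +
    (if i = j then int (vdegree G' (vs ! i)) - 1 else 0)"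
  have entry: "of_int (?h i j) = ltilde_entry (edges G') (vs ! i) (vs ! j)"
    if ij: "i < length vs" "j < length vs" for i j
  proof -
    have "{vs ! i, vs ! j} \<subseteq> verts G''"
      using vs ij nth_mem unfolding enumerates_def by blast
    then have "{vs ! i, vs ! j} \<in> edges G'' \<longleftrightarrow> {vs ! i, vs ! j} \<in> edges G'"
      using assms(2) unfolding induced_subgraph_def by blast
    moreover have "vs ! i = vs ! j \<longleftrightarrow> i = j"
      using vs ij by (simp add: enumerates_def nth_eq_iff_index_eq)
    ultimately show ?thesis
      unfolding ltilde_entry_def vdegree_def by simp
  qed
  show ?thesis
    unfolding Ltilde_def using entry vs vs refl by (rule of_int_abs_det_mat[where h = ?h])
qed

text \<open>On indices below \<open>card I\<close> the function \<open>pick I\<close> is strictly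
  increasing with values in \<open>I\<close>, so it is onto by counting.\<close>

lemma bij_betw_pick:
  assumes "finite I"
  shows "bij_betw (pick I) {..<card I} I"
proof -
  have inj: "inj_on (pick I) {..<card I}"
    by (rule linorder_inj_onI) (auto dest: pick_mono_le[of _ I])
  have "pick I ` {..<card I} \<subseteq> I"
    by (auto intro: pick_in_set_le)
  moreover have "card (pick I ` {..<card I}) = card I"
    by (simp add: card_image[OF inj])
  ultimately have "pick I ` {..<card I} = I"
    by (intro card_subset_eq assms)
  with inj show ?thesis
    by (simp add: bij_betw_def)
qed

lemma enumerates_pick:
  assumes xs: "enumerates xs S" and I: "I \<subseteq> {..<length xs}"
  shows "enumerates (map (\<lambda>i. xs ! pick I i) [0..<card I]) ((!) xs ` I)"
proof -
  have pick: "bij_betw (pick I) {..<card I} I"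
    using I by (intro bij_betw_pick) (auto dest: finite_subset)
  have "inj_on ((!) xs) I"
    using xs I by (intro inj_on_nth) (auto simp: enumerates_def)
  then have "bij_betw ((!) xs) I ((!) xs ` I)"
    by (simp add: bij_betw_def)
  from bij_betw_trans[OF pick this] show ?thesis
    by (auto simp: enumerates_def distinct_map bij_betw_def o_def atLeast0LessThan)
qed

lemma abs_det_submatrix:
  assumes xs: "enumerates xs S" and I: "I \<subseteq> {..<length xs}" and J: "J \<subseteq> {..<length xs}"
    and card: "card I = card J"
  shows "of_int \<bar>det (submatrix (inc_matrix xs) I J)\<bar> =
    abs_det incidence ((!) xs ` I) ((!) xs ` J)"
    and "card ((!) xs ` I) = card ((!) xs ` J)"
proof -
  let ?r = "\<lambda>I. map (\<lambda>i. xs ! pick I i) [0..<card I]"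
  note e = enumerates_pick[OF xs I] enumerates_pick[OF xs J]
  show c: "card ((!) xs ` I) = card ((!) xs ` J)"
    using length_enumerates[OF e(1)] length_enumerates[OF e(2)] card by simp
  have dims: "{i. i < dim_row (inc_matrix xs) \<and> i \<in> I} = I"
    "{j. j < dim_col (inc_matrix xs) \<and> j \<in> J} = J"
    using I J by (auto simp: inc_matrix_def)
  have sub: "submatrix (inc_matrix xs) I J =
      mat (length (?r I)) (length (?r J)) (\<lambda>(i, j). inc_matrix xs $$ (pick I i, pick J j))"
    unfolding submatrix_def dims by simp
  show "of_int \<bar>det (submatrix (inc_matrix xs) I J)\<bar> =
      abs_det incidence ((!) xs ` I) ((!) xs ` J)"
    unfolding sub
  proof (rule of_int_abs_det_mat[OF _ e c])
    fix i j assume "i < length (?r I)" "j < length (?r J)"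
    then have ij: "i < card I" "j < card J"
      by simp_all
    then have "pick I i < length xs" "pick J j < length xs"
      using I J pick_in_set_le by blast+
    with ij show "of_int (inc_matrix xs $$ (pick I i, pick J j)) = incidence (?r I ! i) (?r J ! j)"
      by (simp add: inc_matrix_def incidence_def)
  qed
qed

lemma abs_minorsE:
  assumes "x \<in> abs_minors G"
  obtains R C where "of_int x = abs_det incidence R C" "R \<subseteq> elements G" "C \<subseteq> elements G"
    "card R = card C"
proof -
  obtain xs I J where x: "x = \<bar>det (submatrix (inc_matrix xs) I J)\<bar>"
    "enumerates xs (elements G)" "I \<subseteq> {..<length xs}" "J \<subseteq> {..<length xs}" "card I = card J"
    using assms unfolding abs_minors_def by blast
  moreover have "(!) xs ` I \<subseteq> elements G" "(!) xs ` J \<subseteq> elements G"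
    using x(2-4) by (auto simp: enumerates_def subset_iff)
  ultimately show ?thesis
    using that[of "(!) xs ` I" "(!) xs ` J"] abs_det_submatrix[OF x(2-5)] by simp
qed

lemma principal_minor_in_abs_minors:
  assumes G: "simple_graph G" and S: "S \<subseteq> elements G" "S \<noteq> {}"
    and x: "of_int x = abs_det incidence S S"
  shows "x \<in> abs_minors G"
proof -
  have "finite (elements G)"
    using G by (simp add: elements_def finite_edges simple_graph_def)
  then obtain xs where xs: "enumerates xs (elements G)"
    using ex_enumerates by blast
  \<comment> \<open>The positions of the elements of \<open>S\<close> in \<open>xs\<close>, used for
    both rows and columns.\<close>
  define I where "I = {i. i < length xs \<and> xs ! i \<in> S}"
  have I: "I \<subseteq> {..<length xs}" "(!) xs ` I = S"
    using S(1) xs by (auto simp: I_def enumerates_def in_set_conv_nth image_iff)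
      (metis in_set_conv_nth subset_iff)
  then have "of_int \<bar>det (submatrix (inc_matrix xs) I I)\<bar> = (of_int x :: rat)"
    using abs_det_submatrix(1)[OF xs I(1) I(1) refl] x by simp
  then have "x = \<bar>det (submatrix (inc_matrix xs) I I)\<bar>"
    by simp
  moreover have "I \<noteq> {}"
    using I(2) S(2) by blast
  ultimately show ?thesis
    unfolding abs_minors_def using xs I(1) by blast
qed

section \<open>Nested pairs as a vertex set and an edge set\<close>

text \<open>Keeping all vertices of \<open>G\<close> in \<open>G'\<close> makes every choice of
  \<open>E\<close> admissible, independently of \<open>S\<close>.\<close>

lemma ex_nested_pair:
  assumes G: "simple_graph G" and S: "S \<subseteq> verts G" "S \<noteq> {}" and E: "E \<subseteq> edges G"
  obtains G' G'' vs where "nested_pair G G' G''" "enumerates vs (verts G'')" "edges G' = E"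
    "verts G'' = S" "of_int \<bar>det (Ltilde G' G'' vs)\<bar> = abs_det (ltilde_entry E) S S"
proof -
  let ?G' = "\<lparr>verts = verts G, edges = E\<rparr>" and ?G'' = "\<lparr>verts = S, edges = {e \<in> E. e \<subseteq> S}\<rparr>"
  have simple: "simple_graph ?G'"
    using G E by (auto simp: simple_graph_def)
  have ind: "induced_subgraph ?G'' ?G'"
    using S(1) by (simp add: induced_subgraph_def)
  have "nested_pair G ?G' ?G''"
    using simple ind S(2) E by (simp add: nested_pair_def subgraph_def)
  moreover have "finite S"
    using S(1) G by (auto simp: simple_graph_def dest: finite_subset)
  then obtain vs where "enumerates vs (verts ?G'')"
    using ex_enumerates[of S] by auto
  ultimately show ?thesis
    using that[of ?G' ?G'' vs] abs_det_Ltilde[OF simple ind] by simp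
qed

lemma Ltilde_detsE:
  assumes "x \<in> Ltilde_dets G"
  obtains S E where "of_int x = abs_det (ltilde_entry E) S S" "S \<subseteq> verts G" "S \<noteq> {}"
    "E \<subseteq> edges G"
proof -
  obtain G' G'' vs where x: "x = \<bar>det (Ltilde G' G'' vs)\<bar>" "nested_pair G G' G''"
    "enumerates vs (verts G'')"
    using assms unfolding Ltilde_dets_def by blast
  have "of_int x = abs_det (ltilde_entry (edges G')) (verts G'') (verts G'')"
    unfolding x(1) by (rule abs_det_Ltilde) (use x in \<open>auto simp: nested_pair_def subgraph_def\<close>)
  moreover have "verts G'' \<subseteq> verts G" "verts G'' \<noteq> {}" "edges G' \<subseteq> edges G"
    using x(2) by (auto simp: nested_pair_def subgraph_def induced_subgraph_def)
  ultimately show ?thesis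
    using that by blast
qed

text \<open>Together with \<open>Ltilde_detsE\<close> this describes \<open>Ltilde_dets\<close>
  through a nonempty vertex set and an edge set.\<close>

lemma in_Ltilde_dets:
  assumes "simple_graph G" "S \<subseteq> verts G" "S \<noteq> {}" "E \<subseteq> edges G"
    and x: "of_int x = abs_det (ltilde_entry E) S S"
  shows "x \<in> Ltilde_dets G"
proof -
  obtain G' G'' vs where *: "nested_pair G G' G''" "enumerates vs (verts G'')"
    "of_int \<bar>det (Ltilde G' G'' vs)\<bar> = abs_det (ltilde_entry E) S S"
    using ex_nested_pair[OF assms(1-4)] by metis
  then have "x = \<bar>det (Ltilde G' G'' vs)\<bar>"
    using x by (metis of_int_eq_iff)
  with * show ?thesis
    unfolding Ltilde_dets_def by blast
qed

lemma one_in_Ltilde_dets: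
  assumes "simple_graph G" "verts G \<noteq> {}"
  shows "1 \<in> Ltilde_dets G"
proof -
  obtain v where "v \<in> verts G"
    using assms(2) by blast
  then show ?thesis
    \<comment> \<open>Without edges the degree is 0, and the only entry is
      \<open>0 - 1\<close>.\<close>
    by (intro in_Ltilde_dets[of G "{v}" "{}"]) (use assms in \<open>auto simp: abs_det_singleton ltilde_entry_def\<close>)
qed

section \<open>Equality of the two maxima\<close>

lemma Delta_eq_Max_Ltilde_dets:
  assumes G: "forest G" and ne: "verts G \<noteq> {}"
  shows "Delta G = Max (Ltilde_dets G)"
proof (rule antisym)
  have simple: "simple_graph G"
    using G by (simp add: forest_def)
  then have fin: "finite (verts G)" "finite (edges G)" and two: "\<And>e. e \<in> edges G \<Longrightarrow> card e = 2"
    by (auto simp: simple_graph_def finite_edges)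
  note finL = finite_Ltilde_dets[OF simple] and finM = finite_abs_minors[OF simple]
  have eq: "abs_det incidence (Inl ` S \<union> Inr ` E) (Inl ` S \<union> Inr ` E) = abs_det (ltilde_entry E) S S"
    if "S \<subseteq> verts G" "E \<subseteq> edges G" for S E
    by (rule principal_minor_eq_ltilde) (use that fin two in \<open>auto dest: finite_subset\<close>)
  have "Delta G \<in> abs_minors G"
    unfolding Delta_def by (rule Max_in[OF finM abs_minors_nonempty[OF simple ne]])
  then obtain R C where RC: "of_int (Delta G) = abs_det incidence R C" "R \<subseteq> elements G"
    "C \<subseteq> elements G" "card R = card C"
    by (rule abs_minorsE)
  \<comment> \<open>This bound covers the minors that are zero and those without vertex
    elements.\<close>
  have one: "1 \<le> Max (Ltilde_dets G)"
    using finL one_in_Ltilde_dets[OF simple ne] by (rule Max_ge)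
  from minor_eq_principal[OF G RC(2-4)] show "Delta G \<le> Max (Ltilde_dets G)"
  proof
    assume "abs_det incidence R C = 0"
    with RC(1) one show ?thesis
      by simp
  next
    assume "\<exists>T\<subseteq>elements G. abs_det incidence R C = abs_det incidence T T"
    then obtain T where T: "T \<subseteq> elements G" "abs_det incidence R C = abs_det incidence T T"
      by blast
    define S E where "S = {v. Inl v \<in> T}" and "E = {e. Inr e \<in> T}"
    have "T = Inl ` S \<union> Inr ` E"
    proof (rule Set.set_eqI)
      show "x \<in> T \<longleftrightarrow> x \<in> Inl ` S \<union> Inr ` E" for x
        by (cases x) (auto simp: S_def E_def)
    qed
    moreover have SE: "S \<subseteq> verts G" "E \<subseteq> edges G"
      using T(1) by (auto simp: S_def E_def elements_def)
    ultimately have Delta: "of_int (Delta G) = abs_det (ltilde_entry E) S S"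
      using RC(1) T(2) eq by simp
    show ?thesis
    proof (cases "S = {}")
      \<comment> \<open>With edge elements only, the minor is that of an identity matrix. It
        corresponds to no nested pair, since \<open>G''\<close> must have a vertex.\<close>
      case True
      with Delta have "of_int (Delta G) = (1 :: rat)"
        by simp
      with one show ?thesis
        by simp
    next
      case False
      have "Delta G \<in> Ltilde_dets G"
        by (rule in_Ltilde_dets[OF simple SE(1) False SE(2) Delta])
      with finL show ?thesis
        by (rule Max_ge)
    qed
  qed
  have "Max (Ltilde_dets G) \<in> Ltilde_dets G"
    by (rule Max_in[OF finL Ltilde_dets_nonempty[OF simple ne]])
  then obtain S E where SE: "of_int (Max (Ltilde_dets G)) = abs_det (ltilde_entry E) S S"
    "S \<subseteq> verts G" "S \<noteq> {}" "E \<subseteq> edges G"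
    by (rule Ltilde_detsE)
  \<comment> \<open>Conversely, adjoining the elements of \<open>E\<close> to \<open>S\<close>
    undoes the Schur complement.\<close>
  have "Max (Ltilde_dets G) \<in> abs_minors G"
    by (rule principal_minor_in_abs_minors[OF simple, of "Inl ` S \<union> Inr ` E"])
      (use SE eq in \<open>auto simp: elements_def\<close>)
  with finM show "Max (Ltilde_dets G) \<le> Delta G"
    unfolding Delta_def by (rule Max_ge)
qed

section \<open>A maximizing pair with degrees at least two\<close>

text \<open>Degrees are counted in the fixed set \<open>E\<close>, so deleting vertices from
  \<open>S\<close> does not alter those of the others, and vertices of degree at most one can be
  removed successively. The resulting \<open>T\<close> may be empty, with \<open>abs_det\<close>
  equal to 1.\<close>

lemma ltilde_reduce_low_degree:
  assumes E: "finite E" "\<And>e. e \<in> E \<Longrightarrow> card e = 2"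
    and "finite S" "abs_det (ltilde_entry E) S S \<noteq> 0"
  shows "\<exists>T\<subseteq>S. abs_det (ltilde_entry E) T T = abs_det (ltilde_entry E) S S \<and>
    (\<forall>v\<in>T. 2 \<le> card {e \<in> E. v \<in> e})"
  using assms(3,4)
proof (induction S rule: finite_psubset_induct)
  case (psubset S)
  let ?L = "ltilde_entry E"
  have red: ?case if "S' \<subset> S" "abs_det ?L S S = abs_det ?L S' S'" for S'
  proof -
    have "abs_det ?L S' S' \<noteq> 0"
      using psubset.prems that(2) by simp
    from psubset.IH[OF that(1) this] that show ?thesis
      by (metis order_trans psubset_imp_subset)
  qed
  have loop: "{v} \<notin> E" for v
    using E(2)[of "{v}"] by auto
  show ?case
  proof (cases "\<forall>v\<in>S. 2 \<le> card {e \<in> E. v \<in> e}")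
    case True
    then show ?thesis
      by blast
  next
    case False
    then obtain v where v: "v \<in> S" and deg: "card {e \<in> E. v \<in> e} \<le> 1"
      by force
    have finv: "finite {e \<in> E. v \<in> e}"
      using E(1) by simp
    show ?thesis
    proof (cases "card {e \<in> E. v \<in> e} = 0")
      case True
      then have none: "\<And>e. e \<in> E \<Longrightarrow> v \<notin> e"
        using finv by auto
      have "abs_det ?L S S = abs_det ?L (S - {v}) (S - {v})"
      proof (rule abs_det_single_row)
        show "\<bar>?L v v\<bar> = 1"
          using True loop by (simp add: ltilde_entry_def)
        show "?L v b = 0" if "b \<noteq> v" for b
          using that none[of "{v, b}"] by (auto simp: ltilde_entry_def)
      qed (use psubset.hyps v in auto)
      with v show ?thesis
        by (intro red[of "S - {v}"]) auto
    next
      case False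
      with deg have one: "card {e \<in> E. v \<in> e} = 1"
        by simp
      then obtain e where e: "{e \<in> E. v \<in> e} = {e}"
        by (auto simp: card_1_singleton_iff)
      then have "card e = 2" "v \<in> e"
        using E(2)[of e] by auto
      then obtain w where w: "e = {v, w}" "w \<noteq> v"
        by (auto simp: card_2_iff)
      have vb: "{v, b} \<in> E \<longleftrightarrow> b = w" for b
      proof -
        have "{v, b} \<in> E \<longleftrightarrow> {v, b} \<in> {e \<in> E. v \<in> e}"
          by simp
        then show ?thesis
          unfolding e w(1) using w(2) by (auto simp: doubleton_eq_iff)
      qed
      \<comment> \<open>Degree one makes the diagonal entry zero, so row and column \<open>v\<close>
        contain only a 1 at the neighbour \<open>w\<close>.\<close>
      have entry: "?L v b = (if b = w then 1 else 0)" "?L b v = (if b = w then 1 else 0)" for b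
        using one loop vb[of b] w(2) by (auto simp: ltilde_entry_def insert_commute)
      \<comment> \<open>If \<open>w\<close> were missing, row \<open>v\<close> would vanish on
        \<open>S\<close>, against the nonzero determinant.\<close>
      have "w \<in> S"
      proof (rule ccontr)
        assume "w \<notin> S"
        then have "abs_det ?L S S = 0"
          by (intro abs_det_zero_row[of _ _ v]) (use psubset.hyps v in \<open>auto simp: entry\<close>)
        with psubset.prems show False
          by simp
      qed
      \<comment> \<open>Row \<open>v\<close> is expanded at column \<open>w\<close>, then column
        \<open>v\<close> at row \<open>w\<close>; this keeps the minor principal.\<close>
      have "abs_det ?L S S = abs_det ?L (S - {v}) (S - {w})"
        by (rule abs_det_single_row) (use psubset.hyps v \<open>w \<in> S\<close> in \<open>auto simp: entry\<close>)
      also have "\<dots> = abs_det ?L (S - {v} - {w}) (S - {w} - {v})"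
        by (rule abs_det_single_col) (use psubset.hyps v w \<open>w \<in> S\<close> in \<open>auto simp: entry\<close>)
      also have "S - {v} - {w} = S - {v, w}"
        by auto
      also have "S - {w} - {v} = S - {v, w}"
        by auto
      finally show ?thesis
        by (rule red[rotated]) (use v in auto)
    qed
  qed
qed

text \<open>If all degrees were at most one, edges would be pairwise disjoint, and a component would
  be a single vertex or a single edge.\<close>

lemma ex_vdegree_ge_2:
  assumes G: "simple_graph G" "verts G \<noteq> {}" and big: "\<forall>C\<in>components G. 3 \<le> card C"
  shows "\<exists>v\<in>verts G. 2 \<le> vdegree G v"
proof (rule ccontr)
  assume contra: "\<not> ?thesis"
  have fin: "finite (edges G)"
    by (rule finite_edges[OF G(1)])
  have uniq: "e = e'" if "e \<in> edges G" "e' \<in> edges G" "u \<in> e" "u \<in> e'" for e e' u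
  proof -
    have "u \<in> verts G"
      using G(1) that by (auto simp: simple_graph_def)
    then have "card {e \<in> edges G. u \<in> e} \<le> Suc 0"
      using contra by (auto simp: vdegree_def not_le)
    then show ?thesis
      using card_le_Suc0_iff_eq[of "{e \<in> edges G. u \<in> e}"] fin that by auto
  qed
  obtain v where v: "v \<in> verts G"
    using G(2) by blast
  define C where "C = {u. (v, u) \<in> (adj_rel G)\<^sup>*}"
  have "C \<in> components G"
    unfolding components_def C_def using v by blast
  then have "3 \<le> card C"
    using big by blast
  \<comment> \<open>The candidate for the whole component of \<open>v\<close>: the edge at
    \<open>v\<close> if there is one, else just \<open>v\<close>.\<close>
  define e where "e = (if \<exists>w. {v, w} \<in> edges G then {v, SOME w. {v, w} \<in> edges G} else {v})"
  have e: "e \<in> edges G" if "{v, w} \<in> edges G" for w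
    using someI[of "\<lambda>w. {v, w} \<in> edges G" w] that by (auto simp: e_def)
  have "v \<in> e"
    by (simp add: e_def)
  have closed: "u \<in> e" if "(v, u) \<in> (adj_rel G)\<^sup>*" for u
    using that
  proof (induction rule: rtrancl_induct)
    case base
    show ?case
      by (rule \<open>v \<in> e\<close>)
  next
    case (step y z)
    then have yz: "{y, z} \<in> edges G"
      by (simp add: adj_rel_def)
    \<comment> \<open>If \<open>y\<close> differs from \<open>v\<close>, then membership of
      \<open>y\<close> in \<open>e\<close> rules out the degenerate value
      \<open>{v}\<close>.\<close>
    have "e \<in> edges G"
    proof (cases "y = v")
      case True
      with yz e show ?thesis
        by blast
    next
      case False
      with step.IH obtain w where "{v, w} \<in> edges G"
        by (auto simp: e_def split: if_splits)
      then show ?thesis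
        by (rule e)
    qed
    then have "e = {y, z}"
      using uniq[of e "{y, z}" y] yz step.IH by simp
    then show ?case
      by simp
  qed
  then have "C \<subseteq> e"
    by (auto simp: C_def)
  moreover have "card e \<le> 2" "finite e"
    by (auto simp: e_def card_insert_if)
  ultimately have "card C \<le> 2"
    by (meson card_mono order_trans)
  with \<open>3 \<le> card C\<close> show False
    by simp
qed

theorem theorem3:
  fixes G :: "'a sgraph"
  assumes "forest G" and "verts G \<noteq> {}"
  shows "Delta G = Max (Ltilde_dets G) \<and>
    ((\<forall>C\<in>components G. 3 \<le> card C) \<longrightarrow>
      (\<exists>G' G'' vs. nested_pair G G' G'' \<and> enumerates vs (verts G'') \<and>
        \<bar>det (Ltilde G' G'' vs)\<bar> = Max (Ltilde_dets G) \<and>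
        (\<forall>e\<in>edges G'. \<exists>v\<in>verts G''. v \<in> e) \<and>
        (\<forall>v\<in>verts G''. 2 \<le> vdegree G' v)))"
proof (intro conjI impI)
  show "Delta G = Max (Ltilde_dets G)"
    by (rule Delta_eq_Max_Ltilde_dets[OF assms])
next
  assume big: "\<forall>C\<in>components G. 3 \<le> card C"
  let ?m = "Max (Ltilde_dets G)"
  have simple: "simple_graph G"
    using assms(1) by (simp add: forest_def)
  then have fin: "finite (verts G)" "finite (edges G)" and two: "\<And>e. e \<in> edges G \<Longrightarrow> card e = 2"
    by (auto simp: simple_graph_def finite_edges)
  note finL = finite_Ltilde_dets[OF simple]
  have one: "1 \<le> ?m"
    using finL one_in_Ltilde_dets[OF simple assms(2)] by (rule Max_ge)
  have "?m \<in> Ltilde_dets G"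
    by (rule Max_in[OF finL Ltilde_dets_nonempty[OF simple assms(2)]])
  then obtain S E where SE: "of_int ?m = abs_det (ltilde_entry E) S S"
    "S \<subseteq> verts G" "E \<subseteq> edges G"
    by (rule Ltilde_detsE)
  have finSE: "finite S" "finite E"
    using SE(2,3) fin by (auto dest: finite_subset)
  \<comment> \<open>The maximum is at least 1, which provides the nonzero determinant that the
    reduction requires.\<close>
  have "abs_det (ltilde_entry E) S S \<noteq> 0"
    using one by (simp flip: SE(1))
  then obtain T where T: "T \<subseteq> S" "abs_det (ltilde_entry E) T T = of_int ?m"
    "\<And>v. v \<in> T \<Longrightarrow> 2 \<le> card {e \<in> E. v \<in> e}"
    using ltilde_reduce_low_degree[of E S] finSE two SE(1,3) by (metis subsetD)
  have "\<exists>T E. T \<subseteq> verts G \<and> T \<noteq> {} \<and> E \<subseteq> edges G \<and> abs_det (ltilde_entry E) T T = of_int ?m \<and>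
      (\<forall>v\<in>T. 2 \<le> card {e \<in> E. v \<in> e})"
  proof (cases "T = {}")
    case False
    with T SE show ?thesis
      by blast
  next
    \<comment> \<open>All vertices have been removed, so the maximum is 1, and a nonempty vertex set
      with this value is needed.\<close>
    case True
    with T(2) have m: "of_int ?m = (1 :: rat)"
      by simp
    obtain v where v: "v \<in> verts G" "2 \<le> vdegree G v"
      using ex_vdegree_ge_2[OF simple assms(2) big] by blast
    \<comment> \<open>Exactly two edges at \<open>v\<close> give the single entry
      \<open>2 - 1\<close>.\<close>
    then obtain E' where E': "E' \<subseteq> {e \<in> edges G. v \<in> e}" "card E' = 2"
      unfolding vdegree_def by (meson obtain_subset_with_card_n)
    then have "{e \<in> E'. v \<in> e} = E'" "{v} \<notin> E'"
      using two[of "{v}"] by auto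
    then have "abs_det (ltilde_entry E') {v} {v} = of_int ?m" "\<forall>u\<in>{v}. 2 \<le> card {e \<in> E'. u \<in> e}"
      using E'(2) m by (simp_all add: abs_det_singleton ltilde_entry_def)
    moreover have "E' \<subseteq> edges G" "{v} \<subseteq> verts G" "{v} \<noteq> {}"
      using E'(1) v(1) by auto
    ultimately show ?thesis
      by blast
  qed
  then obtain T E where T: "T \<subseteq> verts G" "T \<noteq> {}" "E \<subseteq> edges G"
    "abs_det (ltilde_entry E) T T = of_int ?m" "\<And>v. v \<in> T \<Longrightarrow> 2 \<le> card {e \<in> E. v \<in> e}"
    by blast
  \<comment> \<open>Discarding the edges that miss \<open>T\<close> gives the covering condition; it
    affects neither degrees of vertices in \<open>T\<close> nor adjacency between them.\<close>
  define E' where "E' = {e \<in> E. \<exists>v\<in>T. v \<in> e}"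
  have star: "{e \<in> E'. v \<in> e} = {e \<in> E. v \<in> e}" if "v \<in> T" for v
    using that by (auto simp: E'_def)
  have "abs_det (ltilde_entry E') T T = abs_det (ltilde_entry E) T T"
  proof (rule abs_det_cong)
    show "finite T" "finite T"
      using T(1) fin(1) by (auto dest: finite_subset)
    show "ltilde_entry E' a b = ltilde_entry E a b" if "a \<in> T" for a b
    proof -
      have "{a, b} \<in> E' \<longleftrightarrow> {a, b} \<in> E"
        using that by (auto simp: E'_def)
      then show ?thesis
        unfolding ltilde_entry_def star[OF that] by simp
    qed
  qed simp
  moreover have "E' \<subseteq> edges G"
    using T(3) by (auto simp: E'_def)
  then obtain G' G'' vs where G': "nested_pair G G' G''" "enumerates vs (verts G'')"
    "edges G' = E'" "verts G'' = T"
    "of_int \<bar>det (Ltilde G' G'' vs)\<bar> = abs_det (ltilde_entry E') T T"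
    using ex_nested_pair[OF simple T(1,2)] by metis
  ultimately have "of_int \<bar>det (Ltilde G' G'' vs)\<bar> = (of_int ?m :: rat)"
    using T(4) by simp
  then have "\<bar>det (Ltilde G' G'' vs)\<bar> = ?m"
    by (simp only: of_int_eq_iff)
  moreover have "\<forall>e\<in>edges G'. \<exists>v\<in>verts G''. v \<in> e"
    unfolding G'(3,4) by (auto simp: E'_def)
  moreover have "\<forall>v\<in>verts G''. 2 \<le> vdegree G' v"
    unfolding vdegree_def G'(3,4) using T(5) star by simp
  ultimately show "\<exists>G' G'' vs. nested_pair G G' G'' \<and> enumerates vs (verts G'') \<and>
      \<bar>det (Ltilde G' G'' vs)\<bar> = ?m \<and> (\<forall>e\<in>edges G'. \<exists>v\<in>verts G''. v \<in> e) \<and>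
      (\<forall>v\<in>verts G''. 2 \<le> vdegree G' v)"
    using G'(1,2) by blast
qed

end
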